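(* Let $k\in\mathbb N$, $n=2^k$, and let $\mathrm{Cay}(\mathbb Z_n,S)$ be a circulant graph such that $|S\cap S_n(d)|\equiv0\pmod 4$ for every proper divisor $d$ of $n$. Then $\mathrm{Cay}(\mathbb Z_n,S)$ is almost periodic with respect to a sequence in $(4\mathbb Z+1)\frac{\pi}{2}$: there exist $\tau_j\in(4\mathbb Z+1)\frac\pi2$ ($j\in\mathbb N$) and $\gamma\in\mathbb C$ with $\lim_{j\to\infty}\exp(-i\tau_jA)=\gamma I$, where $A$ is the adjacency matrix. The same holds with the Laplacian matrix $L$ in place of $A$.
   Context: For a finite abelian group $\Gamma$ and $S\subseteq\Gamma$ with $0\notin S$ and $-S=S$, the Cayley graph $\mathrm{Cay}(\Gamma,S)$ has vertex set $\Gamma$, with $a,b$ adjacent iff $a-b\in S$; for $\Gamma=\mathbb Z_n$ it is a circulant graph. For a proper divisor $d$ of $n$, $S_n(d)=\{x\in\mathbb Z_n:\gcd(x,n)=d\}$. *)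

theory Defs
  imports Complex_Main "Jordan_Normal_Form.Matrix"
begin

definition circ_conn_set :: "nat \<Rightarrow> nat set \<Rightarrow> bool" where
  "circ_conn_set n S \<longleftrightarrow> S \<subseteq> {..<n} \<and> 0 \<notin> S \<and> (\<forall>x\<in>S. (n - x) mod n \<in> S)"

definition Sn :: "nat \<Rightarrow> nat \<Rightarrow> nat set" where
  "Sn n d = {x \<in> {..<n}. gcd x n = d}"

definition proper_divisor :: "nat \<Rightarrow> nat \<Rightarrow> bool" where
  "proper_divisor d n \<longleftrightarrow> d dvd n \<and> d < n"

definition cay_adj :: "nat \<Rightarrow> nat set \<Rightarrow> complex mat" where
  "cay_adj n S = mat n n (\<lambda>(a,b). if (a + n - b) mod n \<in> S then 1 else 0)"

definition laplacian :: "complex mat \<Rightarrow> complex mat" where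
  "laplacian M = mat (dim_row M) (dim_col M)
     (\<lambda>(a,b). if a = b then (\<Sum>c<dim_col M. M $$ (a,c)) else 0) - M"

definition mat_exp :: "complex mat \<Rightarrow> complex mat" where
  "mat_exp M = mat (dim_row M) (dim_col M) (\<lambda>(a,b). \<Sum>m. (M ^\<^sub>m m) $$ (a,b) / fact m)"

definition mat_lim :: "nat \<Rightarrow> (nat \<Rightarrow> complex mat) \<Rightarrow> complex mat \<Rightarrow> bool" where
  "mat_lim n X B \<longleftrightarrow> (\<forall>a<n. \<forall>b<n. (\<lambda>j. X j $$ (a,b)) \<longlonglongrightarrow> B $$ (a,b))"

definition almost_periodic_4Z1 :: "nat \<Rightarrow> complex mat \<Rightarrow> bool" where
  "almost_periodic_4Z1 n M \<longleftrightarrow>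
     (\<exists>\<tau> :: nat \<Rightarrow> real. \<exists>\<gamma> :: complex.
        (\<forall>j. \<exists>m::int. \<tau> j = (4 * of_int m + 1) * pi / 2) \<and>
        mat_lim n (\<lambda>j. mat_exp ((- \<i> * complex_of_real (\<tau> j)) \<cdot>\<^sub>m M)) (\<gamma> \<cdot>\<^sub>m 1\<^sub>m n))"

end

theory Submission
  imports Defs "HOL-Analysis.Kronecker_Approximation_Theorem"
begin

text \<open>
  The eigenvalues of the circulant matrix are the sums of \<open>cos (2 * pi * r * s / n)\<close> over \<open>s \<in> S\<close>.
  Each such cosine is \<open>\<plusminus>1\<close>, \<open>0\<close> or \<open>\<plusminus>cos (2 * pi * j / n)\<close> with \<open>0 < 4 * j < n\<close>, and the terms
  \<open>\<plusminus>1\<close> add up to a multiple of 4. The numbers \<open>\<theta>\<^sub>j = cos (2 * pi * j / n)\<close> with \<open>0 \<le> 4 * j < n\<close>,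
  among which \<open>\<theta>\<^sub>0 = 1\<close>, are linearly independent over the rationals, because the powers
  of a primitive \<open>2\<^sup>k\<close>-th root of unity below the exponent \<open>2\<^sup>k / 2\<close> are. Kronecker's theorem
  therefore provides integers \<open>m\<close> for which all \<open>(m + 1/4) * \<theta>\<^sub>j\<close> with \<open>j > 0\<close> are arbitrarily close
  to integers. At the times \<open>\<tau> = (4 * m + 1) * pi / 2\<close> every \<open>exp (- \<i> * \<tau> * \<lambda>)\<close> then tends to 1,
  both for the eigenvalues \<open>\<lambda>\<close> of the adjacency matrix and for those of the Laplacian, which
  are differences of the former.
\<close>

section \<open>The tower of fields generated by roots of unity of 2-power order\<close>

text \<open>A primitive root of unity of order \<open>2 ^ Suc k\<close>; with this indexing
  \<open>tower k\<close> is the field generated by \<open>rt k\<close>, of degree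
  \<open>2 ^ k\<close> over the rationals.\<close>

definition rt :: "nat \<Rightarrow> complex" where
  "rt k = cis (pi / 2 ^ k)"

lemma rt_0 [simp]: "rt 0 = -1" and rt_1 [simp]: "rt (Suc 0) = \<i>"
  by (simp_all add: rt_def cis_pi_half flip: cis_pi)

lemma rt_Suc_power2: "rt (Suc k) ^ 2 = rt k"
  by (simp add: rt_def Complex.DeMoivre field_simps)

lemma rt_power: "rt k ^ 2 ^ k = -1"
  by (simp add: rt_def Complex.DeMoivre)

text \<open>Each stage adjoins a square root of \<open>rt k\<close>, an element of the stage below,
  so linear expressions in \<open>rt (Suc k)\<close> already form a field.\<close>

fun tower :: "nat \<Rightarrow> complex set" where
  "tower 0 = \<rat>"
| "tower (Suc k) = {a + b * rt (Suc k) | a b. a \<in> tower k \<and> b \<in> tower k}"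

lemma tower_SucI: "a \<in> tower k \<Longrightarrow> b \<in> tower k \<Longrightarrow> a + b * rt (Suc k) \<in> tower (Suc k)"
  by auto

lemma tower_zero: "0 \<in> tower k"
  by (induction k) (force)+

lemma tower_Suc_mono: "x \<in> tower k \<Longrightarrow> x \<in> tower (Suc k)"
  using tower_zero[of k] by (force intro: exI[of _ x])

lemma tower_one: "1 \<in> tower k"
  by (induction k) (simp, blast intro: tower_Suc_mono)

lemma tower_rt: "rt k \<in> tower k"
  using tower_zero tower_one by (cases k) force+

lemma tower_i: "\<i> \<in> tower (Suc k)"
proof (induction k)
  case 0
  show ?case using tower_rt[of 1] by simp
qed (blast intro: tower_Suc_mono)

lemma tower_add: "x \<in> tower k \<Longrightarrow> y \<in> tower k \<Longrightarrow> x + y \<in> tower k"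
proof (induction k arbitrary: x y)
  case (Suc k)
  then obtain a b c d where "x = a + b * rt (Suc k)" "y = c + d * rt (Suc k)"
    and "a \<in> tower k" "b \<in> tower k" "c \<in> tower k" "d \<in> tower k" by auto
  moreover have "a + b * rt (Suc k) + (c + d * rt (Suc k)) = (a + c) + (b + d) * rt (Suc k)"
    by (simp add: algebra_simps)
  ultimately show ?case by (metis Suc.IH tower_SucI)
qed simp

lemma tower_mult: "x \<in> tower k \<Longrightarrow> y \<in> tower k \<Longrightarrow> x * y \<in> tower k"
proof (induction k arbitrary: x y)
  case (Suc k)
  then obtain a b c d where xy: "x = a + b * rt (Suc k)" "y = c + d * rt (Suc k)"
    and mem: "a \<in> tower k" "b \<in> tower k" "c \<in> tower k" "d \<in> tower k" by auto
  have "x * y = (a * c + b * d * rt k) + (a * d + b * c) * rt (Suc k)"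
    by (simp add: xy algebra_simps power2_eq_square flip: rt_Suc_power2[of k])
  moreover have "a * c + b * d * rt k \<in> tower k" "a * d + b * c \<in> tower k"
    using mem by (auto intro!: Suc.IH tower_add tower_rt)
  ultimately show ?case by auto
qed simp

lemma tower_uminus: "x \<in> tower k \<Longrightarrow> - x \<in> tower k"
proof (induction k arbitrary: x)
  case (Suc k)
  then obtain a b where "x = a + b * rt (Suc k)" "a \<in> tower k" "b \<in> tower k" by auto
  moreover have "- (a + b * rt (Suc k)) = - a + - b * rt (Suc k)" by simp
  ultimately show ?case by (metis Suc.IH tower_SucI)
qed simp

lemma tower_diff: "x \<in> tower k \<Longrightarrow> y \<in> tower k \<Longrightarrow> x - y \<in> tower k"
  using tower_add[of x k "- y"] tower_uminus by simp

text \<open>The denominator is rationalised with the conjugate \<open>a - b * rt (Suc k)\<close>.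
  The case of a vanishing conjugate is split off because \<open>rt_Suc_notin_tower\<close> itself
  relies on division; there \<open>x = a + a\<close> lies in the smaller field.\<close>

lemma tower_inverse: "x \<in> tower k \<Longrightarrow> inverse x \<in> tower k"
proof (induction k arbitrary: x)
  case (Suc k)
  then obtain a b where x: "x = a + b * rt (Suc k)" and mem: "a \<in> tower k" "b \<in> tower k" by auto
  show ?case
  proof (cases "a = b * rt (Suc k)")
    case True
    then have "x = a + a" by (simp add: x)
    then have "x \<in> tower k" using tower_add[OF mem(1) mem(1)] by simp
    then show ?thesis using Suc.IH tower_Suc_mono by blast
  next
    case False
    \<comment> \<open>The inverse of the norm of \<open>x\<close> over
      \<open>tower k\<close>.\<close>
    define e where "e = inverse (a * a - b * b * rt k)"
    have "e \<in> tower k"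
      unfolding e_def using mem by (intro Suc.IH tower_diff tower_mult tower_rt)
    moreover have "inverse x = a * e + (- (b * e)) * rt (Suc k)"
    proof (cases "x = 0")
      \<comment> \<open>For \<open>x = 0\<close> the norm is 0 as well, so
        \<open>e = inverse 0 = 0\<close> and both sides vanish.\<close>
      case True
      then have "a = - (b * rt (Suc k))" by (simp add: x eq_neg_iff_add_eq_0)
      then have "a ^ 2 = b ^ 2 * rt k"
        by (simp only: power2_minus power_mult_distrib rt_Suc_power2)
      then have "a * a = b * b * rt k" by (simp only: power2_eq_square)
      then show ?thesis using True by (simp add: e_def)
    next
      case nz: False
      have eq: "a * a - b * b * rt k = x * (a - b * rt (Suc k))"
        unfolding x rt_Suc_power2[of k, symmetric] power2_eq_square by (simp add: algebra_simps)
      have "inverse x = (a - b * rt (Suc k)) * e"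
        using nz False by (simp add: e_def eq)
      then show ?thesis by (simp add: algebra_simps)
    qed
    ultimately show ?thesis
      using mem by (metis tower_SucI tower_mult tower_uminus)
  qed
qed simp

lemma tower_divide: "x \<in> tower k \<Longrightarrow> y \<in> tower k \<Longrightarrow> x / y \<in> tower k"
  by (simp add: divide_inverse tower_mult tower_inverse)

text \<open>The parity argument for the irrationality of the square root of 2; the odd factor
  \<open>e\<close> covers \<open>2\<close> and \<open>-2\<close> together.\<close>

lemma Rats_power2_neq_double_odd:
  fixes x :: "'a :: field_char_0"
  assumes "x \<in> \<rat>" and "odd e"
  shows "x ^ 2 \<noteq> of_int (2 * e)"
proof
  assume sq: "x ^ 2 = of_int (2 * e)"
  obtain a b where x: "x = of_int a / of_int b" "b > 0" "coprime a b"
    using assms(1) by (rule Rats_cases')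
  have "(of_int a :: 'a) ^ 2 = of_int (2 * e) * of_int b ^ 2"
    using sq x by (simp add: power_divide field_simps)
  then have "(of_int (a ^ 2) :: 'a) = of_int (2 * e * b ^ 2)" by simp
  then have eq: "a ^ 2 = 2 * e * b ^ 2" by (simp only: of_int_eq_iff)
  then have "even (a ^ 2)" by simp
  then obtain c where a: "a = 2 * c" by auto
  have "2 * c ^ 2 = e * b ^ 2" using eq by (simp add: a power2_eq_square)
  then have "even (e * b ^ 2)" by (metis dvd_triv_left)
  then have "even b" using assms(2) by simp
  then have "\<not> coprime a b" by (auto simp: a)
  then show False using x by simp
qed

text \<open>If \<open>rt (k + 2) = a + b * rt (k + 1)\<close>, then comparing coefficients in the square gives
  \<open>a\<^sup>2 = - b\<^sup>2 * rt k\<close> and \<open>2 * a * b = 1\<close>. For \<open>k > 0\<close> this puts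
  \<open>\<i> * rt (k + 1) = \<plusminus> a / b\<close>, hence \<open>rt (k + 1)\<close>, into the smaller field; for \<open>k = 0\<close> it makes
  \<open>2\<close> or \<open>-2\<close> a rational square.\<close>

lemma rt_Suc_notin_tower: "rt (Suc k) \<notin> tower k"
proof (induction k)
  case 0
  show ?case
  proof
    assume "rt (Suc 0) \<in> tower 0"
    then obtain a b where "\<i> = of_int a / of_int b" by (auto elim: Rats_cases')
    then have "\<i> = complex_of_real (of_int a / of_int b)" by simp
    then show False by (metis Im_complex_of_real imaginary_unit.simps(2) zero_neq_one)
  qed
next
  case (Suc k)
  note notin = Suc.IH
  show ?case
  proof
    assume "rt (Suc (Suc k)) \<in> tower (Suc k)"
    then obtain a b where ab: "rt (Suc (Suc k)) = a + b * rt (Suc k)"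
      and mem: "a \<in> tower k" "b \<in> tower k" by auto
    have "rt (Suc k) = (a + b * rt (Suc k)) ^ 2"
      by (metis ab rt_Suc_power2)
    also have "\<dots> = a * a + b * b * rt k + (a * b + a * b) * rt (Suc k)"
      unfolding rt_Suc_power2[of k, symmetric] power2_eq_square by (simp add: algebra_simps)
    finally have eq: "a * a + b * b * rt k = (1 - (a * b + a * b)) * rt (Suc k)"
      by (simp add: algebra_simps)
    have one: "a * b + a * b = 1"
    proof (rule ccontr)
      assume "a * b + a * b \<noteq> 1"
      then have "rt (Suc k) = (a * a + b * b * rt k) / (1 - (a * b + a * b))"
        unfolding eq by simp
      also have "\<dots> \<in> tower k"
        using mem by (intro tower_divide tower_diff tower_add tower_mult tower_one tower_rt)
      finally show False using notin by simp
    qed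
    have b: "b \<noteq> 0" using one by auto
    have sq: "(a / b) ^ 2 = - rt k"
      using eq one b by (simp add: power2_eq_square field_simps eq_neg_iff_add_eq_0)
    have mem': "a / b \<in> tower k" using mem by (rule tower_divide)
    show False
    proof (cases k)
      case 0
      have "(a / b) ^ 2 = 1" using sq 0 by simp
      then have "a = b \<or> a = - b" using b by (simp add: power_divide field_simps) (simp add: power2_eq_iff)
      then have "(2 * b) ^ 2 = 2 * (a * b + a * b) \<or> (2 * b) ^ 2 = -2 * (a * b + a * b)"
        by (auto simp: power2_eq_square)
      then have "(2 * b) ^ 2 = 2 \<or> (2 * b) ^ 2 = -2"
        unfolding one by simp
      moreover have "2 * b \<in> \<rat>" using mem 0 by simp
      ultimately show False
        using Rats_power2_neq_double_odd[of "2 * b" 1] Rats_power2_neq_double_odd[of "2 * b" "-1"] by auto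
    next
      case (Suc l)
      have "(a / b) ^ 2 = (\<i> * rt (Suc k)) ^ 2"
        by (simp only: sq power_mult_distrib rt_Suc_power2) simp
      then have "a / b = \<i> * rt (Suc k) \<or> a / b = - (\<i> * rt (Suc k))"
        by (simp only: power2_eq_iff)
      then have "rt (Suc k) = - (\<i> * (a / b)) \<or> rt (Suc k) = \<i> * (a / b)"
        by (auto simp only: mult_minus_right mult.assoc[symmetric] i_squared) auto
      moreover have "\<i> * (a / b) \<in> tower k"
        unfolding Suc by (rule tower_mult[OF tower_i mem'[unfolded Suc]])
      ultimately have "rt (Suc k) \<in> tower k"
        using tower_uminus by auto
      with notin show False by simp
    qed
  qed
qed

lemma sum_even_odd:
  fixes f :: "nat \<Rightarrow> 'a :: comm_monoid_add"
  shows "(\<Sum>j<2 * m. f j) = (\<Sum>j<m. f (2 * j)) + (\<Sum>j<m. f (Suc (2 * j)))"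
  by (induction m) (simp_all add: ac_simps)

lemma tower_sum:
  assumes "\<And>j. j < m \<Longrightarrow> c j \<in> \<rat>"
  shows "(\<Sum>j<m. c j * rt k ^ j) \<in> tower k"
proof -
  have rat: "x \<in> tower k" if "x \<in> \<rat>" for x
    using that by (induction k) (simp, blast intro: tower_Suc_mono)
  have pow: "rt k ^ j \<in> tower k" for j
    by (induction j) (simp_all add: tower_one tower_mult tower_rt)
  show ?thesis using assms
    by (induction m) (simp_all add: tower_zero tower_add tower_mult rat pow)
qed

text \<open>Separating even and odd exponents writes the relation as
  \<open>?E + ?O * rt (Suc k) = 0\<close> with \<open>?E\<close> and \<open>?O\<close> in
  \<open>tower k\<close>. As \<open>rt (Suc k)\<close> is not in \<open>tower k\<close>, both
  vanish, and each is a shorter relation between powers of \<open>rt k\<close>.\<close>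

lemma rt_powers_independent:
  assumes "\<And>j. j < 2 ^ k \<Longrightarrow> c j \<in> \<rat>" and "(\<Sum>j<2 ^ k. c j * rt k ^ j) = 0" and "j < 2 ^ k"
  shows "c j = 0"
  using assms
proof (induction k arbitrary: c j)
  case (Suc k)
  let ?E = "\<Sum>j<2 ^ k. c (2 * j) * rt k ^ j" and ?O = "\<Sum>j<2 ^ k. c (Suc (2 * j)) * rt k ^ j"
  have pw: "rt (Suc k) ^ (2 * j) = rt k ^ j" for j
    by (simp only: power_mult rt_Suc_power2)
  have "?E + ?O * rt (Suc k) = (\<Sum>j<2 ^ Suc k. c j * rt (Suc k) ^ j)"
    unfolding power_Suc sum_even_odd sum_distrib_right pw by (simp add: mult_ac)
  then have z: "?E + ?O * rt (Suc k) = 0" using Suc.prems(2) by simp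
  have mem: "?E \<in> tower k" "?O \<in> tower k"
    using Suc.prems(1) by (auto intro!: tower_sum)
  have O: "?O = 0"
  proof (rule ccontr)
    assume nz: "?O \<noteq> 0"
    have "rt (Suc k) = - ?E / ?O"
      using z nz by (simp add: field_simps eq_neg_iff_add_eq_0)
    then show False
      using mem rt_Suc_notin_tower tower_divide tower_uminus by metis
  qed
  then have E: "?E = 0" using z by simp
  have "c (2 * i) = 0" if "i < 2 ^ k" for i
    using Suc.IH[of "\<lambda>j. c (2 * j)"] Suc.prems(1) E that by auto
  moreover have "c (Suc (2 * i)) = 0" if "i < 2 ^ k" for i
    using Suc.IH[of "\<lambda>j. c (Suc (2 * j))"] Suc.prems(1) O that by auto
  ultimately show ?case
    using Suc.prems(3) by (cases "even j") (auto elim!: evenE oddE)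
qed simp

section \<open>Circulant matrices in the Fourier basis\<close>

text \<open>The standard additive character of the integers modulo \<open>n\<close>; the integer
  argument allows differences of vertices without reduction modulo \<open>n\<close>.\<close>

definition zchar :: "nat \<Rightarrow> int \<Rightarrow> complex" where
  "zchar n t = cis (2 * pi * of_int t / of_nat n)"

lemma zchar_0 [simp]: "zchar n 0 = 1"
  by (simp add: zchar_def)

lemma zchar_add: "zchar n (s + t) = zchar n s * zchar n t"
  by (simp add: zchar_def cis_mult add_divide_distrib distrib_left)

lemma zchar_power: "zchar n (int r * t) = zchar n t ^ r"
  by (simp add: zchar_def Complex.DeMoivre mult_ac)

lemma zchar_eq_1_iff:
  assumes "n > 0"
  shows "zchar n t = 1 \<longleftrightarrow> int n dvd t"
proof
  assume "zchar n t = 1"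
  then have "cos (2 * pi * of_int t / of_nat n) = 1"
    by (simp add: zchar_def complex_eq_iff)
  then obtain m :: int where "2 * pi * of_int t / of_nat n = of_int m * 2 * pi"
    using cos_one_2pi_int by blast
  then have "of_int t = (of_int (m * int n) :: real)"
    using assms by (simp add: field_simps)
  then show "int n dvd t" by (simp only: of_int_eq_iff) simp
next
  assume "int n dvd t"
  then obtain m where "t = int n * m" by blast
  then show "zchar n t = 1"
    using assms cis_multiple_2pi[of "of_int m"] by (simp add: zchar_def mult_ac)
qed

text \<open>Orthogonality of characters: a geometric sum whose ratio is an \<open>n\<close>-th root
  of unity.\<close>

lemma sum_zchar:
  assumes "n > 0"
  shows "(\<Sum>r<n. zchar n (int r * t)) = (if int n dvd t then of_nat n else 0)"
proof (cases "int n dvd t")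
  case True
  then have "zchar n (int r * t) = 1" for r
    using assms by (simp add: zchar_eq_1_iff)
  then show ?thesis using True by simp
next
  case False
  have "zchar n t ^ n = 1"
    using assms by (simp add: zchar_eq_1_iff flip: zchar_power)
  then show ?thesis
    using False assms by (simp add: zchar_power geometric_sum zchar_eq_1_iff)
qed

lemma int_dvd_diff_iff_eq:
  assumes "r < n" "s < n"
  shows "int n dvd int r - int s \<longleftrightarrow> r = s"
  using assms by (metis mod_eq_dvd_iff mod_less of_nat_eq_iff of_nat_mod)

text \<open>The circulant matrix with eigenvalue \<open>\<mu> r\<close> on the character
  \<open>a \<mapsto> zchar n (int r * a)\<close>. Matrix operations thereby become pointwise
  operations on \<open>\<mu>\<close>.\<close>

definition fourier_mat :: "nat \<Rightarrow> (nat \<Rightarrow> complex) \<Rightarrow> complex mat" where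
  "fourier_mat n \<mu> = Matrix.mat n n (\<lambda>(a,b). (\<Sum>r<n. \<mu> r * zchar n (int r * (int a - int b))) / of_nat n)"

lemma fourier_mat_dims [simp]: "dim_row (fourier_mat n \<mu>) = n" "dim_col (fourier_mat n \<mu>) = n"
  by (simp_all add: fourier_mat_def)

lemma fourier_mat_index:
  "a < n \<Longrightarrow> b < n \<Longrightarrow> fourier_mat n \<mu> $$ (a,b)
     = (\<Sum>r<n. \<mu> r * zchar n (int r * (int a - int b))) / of_nat n"
  by (simp add: fourier_mat_def)

lemma fourier_mat_one: "fourier_mat n (\<lambda>_. 1) = 1\<^sub>m n"
proof (rule eq_matI)
  fix a b assume "a < dim_row (1\<^sub>m n)" "b < dim_col (1\<^sub>m n)"
  then show "fourier_mat n (\<lambda>_. 1) $$ (a,b) = 1\<^sub>m n $$ (a,b)"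
    using sum_zchar[of n "int a - int b"]
    by (auto simp: fourier_mat_index int_dvd_diff_iff_eq)
qed simp_all

lemma fourier_mat_smult: "c \<cdot>\<^sub>m fourier_mat n \<mu> = fourier_mat n (\<lambda>r. c * \<mu> r)"
  by (rule eq_matI) (simp_all add: fourier_mat_index sum_distrib_left mult.assoc)

lemma fourier_mat_diff: "fourier_mat n \<mu> - fourier_mat n \<nu> = fourier_mat n (\<lambda>r. \<mu> r - \<nu> r)"
  by (rule eq_matI) (simp_all add: fourier_mat_index left_diff_distrib sum_subtractf diff_divide_distrib)

text \<open>Once the sum over the middle index \<open>b\<close> is moved innermost, orthogonality
  leaves only the terms with \<open>s = r\<close>.\<close>

lemma fourier_mat_mult: "fourier_mat n \<mu> * fourier_mat n \<nu> = fourier_mat n (\<lambda>r. \<mu> r * \<nu> r)"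
proof (rule eq_matI)
  fix a c assume "a < dim_row (fourier_mat n (\<lambda>r. \<mu> r * \<nu> r))" "c < dim_col (fourier_mat n (\<lambda>r. \<mu> r * \<nu> r))"
  then have ac: "a < n" "c < n" and n: "n > 0" by auto
  have "(fourier_mat n \<mu> * fourier_mat n \<nu>) $$ (a,c)
      = (\<Sum>b<n. fourier_mat n \<mu> $$ (a,b) * fourier_mat n \<nu> $$ (b,c))"
    using ac by (simp add: scalar_prod_def lessThan_atLeast0)
  also have "\<dots> = (\<Sum>b<n. \<Sum>r<n. \<Sum>s<n.
      \<mu> r * zchar n (int r * (int a - int b)) * (\<nu> s * zchar n (int s * (int b - int c)))) / of_nat n ^ 2"
    using ac by (simp add: fourier_mat_index sum_product power2_eq_square sum_divide_distrib)
  also have "(\<Sum>b<n. \<Sum>r<n. \<Sum>s<n.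
      \<mu> r * zchar n (int r * (int a - int b)) * (\<nu> s * zchar n (int s * (int b - int c))))
     = (\<Sum>r<n. \<Sum>s<n. \<Sum>b<n. 
      \<mu> r * zchar n (int r * (int a - int b)) * (\<nu> s * zchar n (int s * (int b - int c))))"
    by (subst sum.swap, rule sum.cong, simp, rule sum.swap)
  also have "\<dots> = (\<Sum>r<n. \<Sum>s<n. \<mu> r * \<nu> s * zchar n (int r * int a - int s * int c)
      * (\<Sum>b<n. zchar n (int b * (int s - int r))))"
    unfolding sum_distrib_left
    by (intro sum.cong refl) (simp add: algebra_simps flip: zchar_add)
  also have "\<dots> = (\<Sum>r<n. \<Sum>s<n. if s = r then \<mu> r * \<nu> s * zchar n (int r * int a - int s * int c) * of_nat n else 0)"
    using n by (intro sum.cong refl) (simp add: sum_zchar int_dvd_diff_iff_eq)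
  also have "\<dots> = (\<Sum>r<n. \<mu> r * \<nu> r * zchar n (int r * (int a - int c))) * of_nat n"
    by (simp add: sum.delta sum_distrib_right mult.assoc right_diff_distrib)
  finally show "(fourier_mat n \<mu> * fourier_mat n \<nu>) $$ (a,c) = fourier_mat n (\<lambda>r. \<mu> r * \<nu> r) $$ (a,c)"
    using ac n by (simp add: fourier_mat_index power2_eq_square)
qed simp_all

lemma fourier_mat_pow: "fourier_mat n \<mu> ^\<^sub>m m = fourier_mat n (\<lambda>r. \<mu> r ^ m)"
  by (induction m) (simp_all add: fourier_mat_one fourier_mat_mult mult.commute)

text \<open>Each entry of the power series is a finite linear combination of scalar exponential
  series.\<close>

lemma mat_exp_fourier_mat: "mat_exp (fourier_mat n \<mu>) = fourier_mat n (\<lambda>r. exp (\<mu> r))"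
proof (rule eq_matI)
  fix a b assume "a < dim_row (fourier_mat n (\<lambda>r. exp (\<mu> r)))" "b < dim_col (fourier_mat n (\<lambda>r. exp (\<mu> r)))"
  then have ab: "a < n" "b < n" by auto
  have "(\<lambda>m. (\<Sum>r<n. \<mu> r ^ m /\<^sub>R fact m * zchar n (int r * (int a - int b))) / of_nat n) sums
      ((\<Sum>r<n. exp (\<mu> r) * zchar n (int r * (int a - int b))) / of_nat n)"
    by (intro sums_divide sums_sum sums_mult2 exp_converges)
  then have "(\<lambda>m. (fourier_mat n \<mu> ^\<^sub>m m) $$ (a,b) / fact m) sums fourier_mat n (\<lambda>r. exp (\<mu> r)) $$ (a,b)"
    using ab by (simp add: fourier_mat_pow fourier_mat_index sum_divide_distrib scaleR_conv_of_real field_simps)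
  then show "mat_exp (fourier_mat n \<mu>) $$ (a,b) = fourier_mat n (\<lambda>r. exp (\<mu> r)) $$ (a,b)"
    using ab by (simp add: mat_exp_def sums_iff)
qed (simp_all add: mat_exp_def)

text \<open>Summing a row annihilates every character except the trivial one, so all row sums equal
  \<open>\<mu> 0\<close> and the degree matrix is scalar.\<close>

lemma laplacian_fourier_mat:
  "laplacian (fourier_mat n \<mu>) = fourier_mat n (\<lambda>r. \<mu> 0 - \<mu> r)"
proof -
  have row: "(\<Sum>c<n. fourier_mat n \<mu> $$ (a,c)) = \<mu> 0" if a: "a < n" for a
  proof -
    have n: "n > 0" using a by simp
    have "(\<Sum>c<n. fourier_mat n \<mu> $$ (a,c)) 
       = (\<Sum>r<n. \<Sum>c<n. \<mu> r * zchar n (int r * (int a - int c))) / of_nat n"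
      using a by (subst sum.swap) (simp add: fourier_mat_index sum_divide_distrib)
    also have "(\<Sum>r<n. \<Sum>c<n. \<mu> r * zchar n (int r * (int a - int c)))
       = (\<Sum>r<n. \<mu> r * zchar n (int r * int a) * (\<Sum>c<n. zchar n (int c * (0 - int r))))"
      unfolding sum_distrib_left
      by (intro sum.cong refl) (simp add: algebra_simps flip: zchar_add)
    also have "\<dots> = (\<Sum>r<n. if r = 0 then \<mu> 0 * of_nat n else 0)"
      using n int_dvd_diff_iff_eq[of 0 n] by (intro sum.cong refl) (subst sum_zchar, auto)
    finally show ?thesis using n by (simp add: sum.delta)
  qed
  have "laplacian (fourier_mat n \<mu>) = \<mu> 0 \<cdot>\<^sub>m fourier_mat n (\<lambda>_. 1) - fourier_mat n \<mu>"
    by (rule eq_matI) (auto simp: laplacian_def row fourier_mat_one)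
  then show ?thesis
    by (simp add: fourier_mat_smult fourier_mat_diff)
qed

text \<open>By orthogonality, each \<open>s\<close> contributes the indicator of
  \<open>a - b\<close> being congruent to \<open>s\<close> modulo \<open>n\<close>.\<close>

lemma cay_adj_fourier_mat:
  assumes "S \<subseteq> {..<n}"
  shows "cay_adj n S = fourier_mat n (\<lambda>r. \<Sum>s\<in>S. zchar n (- (int r * int s)))"
proof (rule eq_matI)
  fix a b assume "a < dim_row (fourier_mat n (\<lambda>r. \<Sum>s\<in>S. zchar n (- (int r * int s))))"
    "b < dim_col (fourier_mat n (\<lambda>r. \<Sum>s\<in>S. zchar n (- (int r * int s))))"
  then have ab: "a < n" "b < n" and n: "n > 0" by auto
  have fin: "finite S" using assms finite_subset by blast
  \<comment> \<open>Since \<open>b < n\<close>, the subtraction in \<open>a + n - b\<close> is not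
    truncated and represents \<open>int a - int b\<close> modulo \<open>n\<close>.\<close>
  have iff: "int n dvd int a - int b - int s \<longleftrightarrow> s = (a + n - b) mod n" if "s \<in> S" for s
  proof -
    have s: "s < n" using assms that by auto
    have "int ((a + n - b) mod n) = (int a - int b) mod int n"
      using ab mod_add_self2[of "int a - int b" "int n"]
      by (simp add: of_nat_mod of_nat_diff algebra_simps)
    moreover have "int s = int s mod int n" using s by simp
    ultimately show ?thesis
      by (metis (no_types, lifting) mod_eq_dvd_iff of_nat_eq_iff)
  qed
  have "fourier_mat n (\<lambda>r. \<Sum>s\<in>S. zchar n (- (int r * int s))) $$ (a,b)
     = (\<Sum>r<n. \<Sum>s\<in>S. zchar n (int r * (int a - int b - int s))) / of_nat n"
    using ab by (simp add: fourier_mat_index sum_distrib_right algebra_simps flip: zchar_add)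
  also have "\<dots> = (\<Sum>s\<in>S. if s = (a + n - b) mod n then 1 else 0)"
    using n by (subst sum.swap) (auto simp: sum_zchar iff sum_divide_distrib intro!: sum.cong)
  finally show "cay_adj n S $$ (a,b) = fourier_mat n (\<lambda>r. \<Sum>s\<in>S. zchar n (- (int r * int s))) $$ (a,b)"
    using ab fin by (simp add: cay_adj_def sum.delta)
qed (simp_all add: cay_adj_def)

text \<open>The scalar \<open>\<gamma>\<close> is 1. Being real, this limit is unaffected by the
  conjugation that turns \<open>exp (- \<i> * \<tau> * \<mu>)\<close> into
  \<open>cis (\<tau> * \<mu>)\<close>.\<close>

lemma almost_periodic_fourier_mat:
  fixes \<mu> :: "nat \<Rightarrow> real"
  assumes \<tau>: "\<And>i. \<exists>m::int. \<tau> i = (4 * of_int m + 1) * pi / 2"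
    and lim: "\<And>r. r < n \<Longrightarrow> (\<lambda>i. cis (\<tau> i * \<mu> r)) \<longlonglongrightarrow> 1"
  shows "almost_periodic_4Z1 n (fourier_mat n (\<lambda>r. of_real (\<mu> r)))"
proof -
  have "mat_lim n (\<lambda>j. mat_exp ((- \<i> * complex_of_real (\<tau> j)) \<cdot>\<^sub>m fourier_mat n (\<lambda>r. of_real (\<mu> r)))) (1 \<cdot>\<^sub>m 1\<^sub>m n)"
    unfolding mat_lim_def
  proof (intro allI impI)
    fix a b assume ab: "a < n" "b < n"
    have exp_eq: "exp (- \<i> * complex_of_real (\<tau> j) * of_real (\<mu> r)) = cnj (cis (\<tau> j * \<mu> r))" for j r
      by (simp add: cis_cnj) (simp add: cis_conv_exp mult_ac)
    have "(\<lambda>j. (\<Sum>r<n. cnj (cis (\<tau> j * \<mu> r)) * zchar n (int r * (int a - int b))) / of_nat n) \<longlonglongrightarrow>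
        (\<Sum>r<n. cnj 1 * zchar n (int r * (int a - int b))) / of_nat n"
      using ab by (intro tendsto_intros lim) auto
    moreover have "(\<Sum>r<n. cnj 1 * zchar n (int r * (int a - int b))) / of_nat n = (1 \<cdot>\<^sub>m 1\<^sub>m n) $$ (a,b)"
      using ab by (simp add: fourier_mat_index flip: fourier_mat_one)
    moreover have "mat_exp ((- \<i> * complex_of_real (\<tau> j)) \<cdot>\<^sub>m fourier_mat n (\<lambda>r. of_real (\<mu> r))) $$ (a,b)
        = (\<Sum>r<n. cnj (cis (\<tau> j * \<mu> r)) * zchar n (int r * (int a - int b))) / of_nat n" for j
      unfolding fourier_mat_smult mat_exp_fourier_mat fourier_mat_index[OF ab] exp_eq by (rule refl)
    ultimately show "(\<lambda>j. mat_exp ((- \<i> * complex_of_real (\<tau> j)) \<cdot>\<^sub>m fourier_mat n (\<lambda>r. of_real (\<mu> r))) $$ (a,b))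
        \<longlonglongrightarrow> (1 \<cdot>\<^sub>m 1\<^sub>m n) $$ (a,b)"
      by (simp only:)
  qed
  then show ?thesis
    unfolding almost_periodic_4Z1_def using \<tau> by blast
qed

section \<open>Simultaneous approximation of the cosines\<close>

text \<open>Twice a cosine is \<open>z ^ i - z ^ (2 * M - i)\<close>, because
  \<open>z ^ (2 * M) = -1\<close>. A relation between the cosines thus becomes one between the
  independent powers of \<open>z\<close> below \<open>2 * M\<close>.\<close>

lemma cos_multiples_independent:
  fixes c :: "nat \<Rightarrow> int"
  assumes sum: "(\<Sum>j<2 ^ k. of_int (c j) * cos (pi * real j / 2 ^ Suc k)) = 0" and j: "j < 2 ^ k"
  shows "c j = 0"
proof -
  define M where "M = (2 :: nat) ^ k"
  have M: "M > 0" "2 ^ Suc k = 2 * M" by (simp_all add: M_def)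
  define z where "z = rt (Suc k)"
  \<comment> \<open>The coefficient of \<open>z ^ i\<close>. At 0 the partner exponent
    \<open>2 * M\<close> is out of range and \<open>2 * cos 0 = 2\<close>; the exponent
    \<open>M\<close> belongs to \<open>cos (pi / 2)\<close>, which is not in the family.\<close>
  define d where "d i = (if i = 0 then 2 * c 0 else if i < M then c i
      else if i = M then 0 else - c (2 * M - i))" for i
  have cos2: "of_real (2 * cos (pi * real i / 2 ^ Suc k)) = z ^ i - z ^ (2 * M - i)" if "i < 2 * M" for i
  proof -
    have zi: "z ^ i = cis (pi * real i / 2 ^ Suc k)"
      by (simp add: z_def rt_def Complex.DeMoivre mult_ac)
    have "z ^ (i + (2 * M - i)) = - 1"
      using that rt_power[of "Suc k"] unfolding M(2) z_def by simp
    then have "z ^ i * z ^ (2 * M - i) = - 1" by (simp only: power_add)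
    moreover have "cnj (z ^ i) * z ^ i = 1" by (simp add: zi cis_cnj cis_mult)
    ultimately have "z ^ (2 * M - i) = - cnj (z ^ i)"
      by (metis mult.assoc mult_1 mult_minus1_right)
    then show ?thesis by (simp add: zi complex_eq_iff)
  qed
  have "(\<Sum>i<2 * M. of_int (d i) * z ^ i) = of_int (d 0) + (\<Sum>i\<in>{1..<M}. of_int (d i) * z ^ i)
      + (\<Sum>i\<in>{M<..<2 * M}. of_int (d i) * z ^ i)"
  proof -
    have "{..<2 * M} = insert 0 (insert M ({1..<M} \<union> {M<..<2 * M}))" using M(1) by auto
    moreover have "{1..<M} \<inter> {M<..<2 * M} = {}" by auto
    moreover have "d M = 0" using M(1) by (simp add: d_def)
    ultimately show ?thesis using M(1) by (simp add: sum.union_disjoint del: One_nat_def)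
  qed
  also have "(\<Sum>i\<in>{M<..<2 * M}. of_int (d i) * z ^ i) = (\<Sum>i\<in>{1..<M}. - of_int (c i) * z ^ (2 * M - i))"
    by (rule sum.reindex_bij_witness[of _ "\<lambda>i. 2 * M - i" "\<lambda>i. 2 * M - i"]) (auto simp: d_def)
  also have "(\<Sum>i\<in>{1..<M}. of_int (d i) * z ^ i) = (\<Sum>i\<in>{1..<M}. of_int (c i) * z ^ i)"
    by (rule sum.cong) (auto simp: d_def)
  finally have "(\<Sum>i<2 * M. of_int (d i) * z ^ i)
      = of_int (2 * c 0) + (\<Sum>i\<in>{1..<M}. of_int (c i) * (z ^ i - z ^ (2 * M - i)))"
    by (simp add: d_def sum.distrib sum_subtractf sum_negf right_diff_distrib)
  also have "\<dots> = of_real (of_int (c 0) * 2) 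
      + (\<Sum>i\<in>{1..<M}. of_real (of_int (c i) * (2 * cos (pi * real i / 2 ^ Suc k))))"
    by (intro arg_cong2[of _ _ _ _ "(+)"] sum.cong) (auto simp: cos2[symmetric])
  also have "\<dots> = of_real (2 * (\<Sum>i<M. of_int (c i) * cos (pi * real i / 2 ^ Suc k)))"
  proof -
    have "{..<M} = insert 0 {1..<M}" using M(1) by auto
    then show ?thesis by (simp add: sum_distrib_left mult_ac)
  qed
  also have "\<dots> = 0" using sum by (simp add: M_def)
  finally have "of_int (d i) = (0 :: complex)" if "i < 2 * M" for i
    using rt_powers_independent[of "Suc k" "\<lambda>i. of_int (d i)" i] that unfolding M(2) z_def by simp
  from this[of j] show ?thesis
    using j by (auto simp: d_def M_def split: if_splits)
qed

lemma cos_multiples_inj: "inj_on (\<lambda>j. cos (pi * real j / 2 ^ Suc k)) {..<2 ^ k}"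
proof (rule inj_onI)
  fix i j :: nat assume ij: "i \<in> {..<2 ^ k}" "j \<in> {..<2 ^ k}"
    and eq: "cos (pi * real i / 2 ^ Suc k) = cos (pi * real j / 2 ^ Suc k)"
  have bound: "0 \<le> pi * real x / 2 ^ Suc k" "pi * real x / 2 ^ Suc k \<le> pi" if "x \<in> {..<2 ^ k}" for x
  proof -
    have "x \<le> 2 ^ Suc k" using that by simp
    then have "real x \<le> real (2 ^ Suc k)" by (simp only: of_nat_le_iff)
    then show "0 \<le> pi * real x / 2 ^ Suc k" "pi * real x / 2 ^ Suc k \<le> pi"
      by (simp_all add: field_simps)
  qed
  have "pi * real i / 2 ^ Suc k = pi * real j / 2 ^ Suc k"
    by (rule cos_inj_pi[OF bound[OF ij(1)] bound[OF ij(2)] eq])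
  then show "i = j" by simp
qed

text \<open>The factor \<open>m + 1 / 4\<close> is \<open>\<tau> / (2 * pi)\<close> for
  \<open>\<tau> = (4 * m + 1) * pi / 2\<close>. The index 0 is excluded, since
  \<open>m + 1 / 4\<close> itself stays away from the integers.\<close>

lemma kronecker_quarter:
  assumes "\<epsilon> > 0"
  shows "\<exists>m :: int. \<forall>j. 0 < j \<and> j < 2 ^ k \<longrightarrow> (\<exists>h :: int.
    \<bar>(of_int m + 1 / 4) * cos (pi * real j / 2 ^ Suc k) - of_int h\<bar> < \<epsilon>)"
proof -
  define C where "C j = cos (pi * real j / 2 ^ Suc k)" for j :: nat
  define N where "N = (2 :: nat) ^ k - 1"
  have N: "{..<2 ^ k} = {..N}" by (auto simp: N_def Suc_le_eq less_Suc_eq_le intro: le_less_trans)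
  \<comment> \<open>Enumerated backwards because Kronecker's theorem wants the number 1, here \<open>C 0\<close>, last.\<close>
  define \<theta> where "\<theta> i = C (N - i)" for i
  interpret Z: Modules.module "\<lambda>r x. real_of_int r * x"
    by (simp add: Modules.module.intro distrib_left mult.commute)
  have inj: "inj_on C {..N}"
    using cos_multiples_inj[of k] unfolding C_def N[symmetric] .
  have img: "\<theta> ` {..N} = C ` {..N}"
  proof -
    have "x \<in> (\<lambda>i. N - i) ` {..N}" if "x \<le> N" for x
      by (rule image_eqI[of _ _ "N - x"]) (use that in auto)
    then have "(\<lambda>i. N - i) ` {..N} = {..N}" by auto
    then show ?thesis by (metis (no_types, lifting) \<theta>_def image_cong image_image)
  qed
  have "Z.independent (C ` {..N})"
  proof (rule notI)
    assume "Z.dependent (C ` {..N})"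
    then obtain u where u: "\<exists>v\<in>C ` {..N}. u v \<noteq> 0" "(\<Sum>v\<in>C ` {..N}. real_of_int (u v) * v) = 0"
      by (auto simp: Z.dependent_finite)
    then have "(\<Sum>j<2 ^ k. real_of_int (u (C j)) * C j) = 0"
      by (simp add: sum.reindex[OF inj] N)
    then have "u (C j) = 0" if "j < 2 ^ k" for j
      using cos_multiples_independent[of "\<lambda>j. u (C j)" k j, folded C_def] that by blast
    then show False using u(1) by (auto simp flip: N)
  qed
  then have indep: "module.independent (\<lambda>r x. real_of_int r * x) (\<theta> ` {..N})"
    by (simp add: img)
  have inj\<theta>: "inj_on \<theta> {..N}"
    by (rule eq_card_imp_inj_on) (simp_all add: img card_image inj)
  \<comment> \<open>The target \<open>- \<theta> i / 4\<close> absorbs the shift by a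
    quarter.\<close>
  obtain m h where mh: "\<And>i. i < N \<Longrightarrow> \<bar>of_int m * \<theta> i - of_int (h i) - (- \<theta> i / 4)\<bar> < \<epsilon>"
    using Kronecker_thm_2[OF indep inj\<theta> _ assms, of "\<lambda>i. - \<theta> i / 4"] by (auto simp: \<theta>_def C_def)
  show ?thesis
  proof (rule exI[of _ m], intro allI impI)
    fix j :: nat assume "0 < j \<and> j < 2 ^ k"
    then have "N - j < N" "N - (N - j) = j" by (auto simp: N_def)
    then show "\<exists>h::int. \<bar>(of_int m + 1 / 4) * cos (pi * real j / 2 ^ Suc k) - of_int h\<bar> < \<epsilon>"
      using mh[of "N - j"] by (auto simp: \<theta>_def C_def algebra_simps intro!: exI[of _ "h (N - j)"])
  qed
qed

lemma recurrent_times: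
  obtains \<tau> :: "nat \<Rightarrow> real" where
    "\<And>i. \<exists>m::int. \<tau> i = (4 * of_int m + 1) * pi / 2"
    "\<And>j. 0 < j \<Longrightarrow> j < 2 ^ k \<Longrightarrow> (\<lambda>i. cis (\<tau> i * cos (pi * real j / 2 ^ Suc k))) \<longlonglongrightarrow> 1"
proof -
  have "\<forall>i. \<exists>m :: int. \<forall>j. 0 < j \<and> j < 2 ^ k \<longrightarrow> (\<exists>h :: int.
      \<bar>(of_int m + 1 / 4) * cos (pi * real j / 2 ^ Suc k) - of_int h\<bar> < inverse (real (Suc i)))"
    by (intro allI kronecker_quarter) simp
  then obtain m :: "nat \<Rightarrow> int" where m: "\<And>i j. 0 < j \<Longrightarrow> j < 2 ^ k \<Longrightarrow> \<exists>h :: int.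
      \<bar>(of_int (m i) + 1 / 4) * cos (pi * real j / 2 ^ Suc k) - of_int h\<bar> < inverse (real (Suc i))"
    by metis
  define \<tau> where "\<tau> i = (4 * of_int (m i) + 1) * pi / 2" for i
  show thesis
  proof
    show "\<exists>m::int. \<tau> i = (4 * of_int m + 1) * pi / 2" for i
      by (auto simp: \<tau>_def)
  next
    fix j :: nat assume j: "0 < j" "j < 2 ^ k"
    define c where "c = cos (pi * real j / 2 ^ Suc k)"
    obtain h :: "nat \<Rightarrow> int" where
      h: "\<And>i. \<bar>(of_int (m i) + 1 / 4) * c - of_int (h i)\<bar> < inverse (real (Suc i))"
      using m[OF j] unfolding c_def by metis
    define e where "e i = (of_int (m i) + 1 / 4) * c - of_int (h i)" for i
    have "e \<longlonglongrightarrow> 0"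
      by (rule tendsto_rabs_zero_cancel, rule tendsto_sandwich[OF _ _ tendsto_const LIMSEQ_inverse_real_of_nat])
        (use h in \<open>auto simp: e_def intro!: always_eventually less_imp_le\<close>)
    then have "(\<lambda>i. cis (2 * pi * e i)) \<longlonglongrightarrow> cis (2 * pi * 0)"
      by (intro tendsto_intros)
    moreover have "cis (\<tau> i * c) = cis (2 * pi * e i)" for i
    proof -
      \<comment> \<open>Here \<open>\<tau> i = 2 * pi * (m i + 1 / 4)\<close>.\<close>
      have "\<tau> i * c = 2 * pi * e i + 2 * pi * of_int (h i)"
        by (simp add: \<tau>_def e_def field_simps)
      then show ?thesis by (simp add: flip: cis_mult)
    qed
    ultimately show "(\<lambda>i. cis (\<tau> i * cos (pi * real j / 2 ^ Suc k))) \<longlonglongrightarrow> 1"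
      by (simp add: c_def)
  qed
qed

section \<open>Recurrence of the eigenvalues\<close>

text \<open>Together with the next two lemmas: the frequencies along which \<open>cis\<close> tends
  to 1 form an additive group.\<close>

lemma tendsto_cis_add:
  assumes "(\<lambda>i. cis (\<tau> i * x)) \<longlonglongrightarrow> 1" "(\<lambda>i. cis (\<tau> i * y)) \<longlonglongrightarrow> 1"
  shows "(\<lambda>i. cis (\<tau> i * (x + y))) \<longlonglongrightarrow> 1"
  using tendsto_mult[OF assms] by (simp add: cis_mult distrib_left)

lemma tendsto_cis_minus:
  assumes "(\<lambda>i. cis (\<tau> i * x)) \<longlonglongrightarrow> 1"
  shows "(\<lambda>i. cis (\<tau> i * (- x))) \<longlonglongrightarrow> 1"
  using tendsto_cnj[OF assms] by (simp add: cis_cnj)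

lemma tendsto_cis_sum:
  assumes "\<And>s. s \<in> S \<Longrightarrow> (\<lambda>i. cis (\<tau> i * f s)) \<longlonglongrightarrow> 1"
  shows "(\<lambda>i. cis (\<tau> i * (\<Sum>s\<in>S. f s))) \<longlonglongrightarrow> 1"
  using assms by (induction S rule: infinite_finite_induct) (simp_all add: tendsto_cis_add)

text \<open>For such frequencies \<open>\<tau> i * a\<close> is exactly a multiple of
  \<open>2 * pi\<close>.\<close>

lemma tendsto_cis_multiple_4:
  assumes \<tau>: "\<And>i. \<exists>m::int. \<tau> i = (4 * of_int m + 1) * pi / 2" and "4 dvd a"
  shows "(\<lambda>i. cis (\<tau> i * real_of_int a)) \<longlonglongrightarrow> 1"
proof -
  obtain b where a: "a = 4 * b" using assms(2) by blast
  have "cis (\<tau> i * real_of_int a) = 1" for i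
  proof -
    obtain m :: int where "\<tau> i = (4 * of_int m + 1) * pi / 2" using \<tau> by blast
    then have "\<tau> i * real_of_int a = 2 * pi * real_of_int ((4 * m + 1) * b)"
      by (simp only: a of_int_mult of_int_add of_int_numeral of_int_1) simp
    then show ?thesis by (metis Ints_of_int cis_multiple_2pi)
  qed
  then show ?thesis by simp
qed

text \<open>Shifting \<open>x\<close> by \<open>2 * M\<close> adds \<open>pi\<close> to the angle,
  and reflecting \<open>y\<close> to \<open>2 * M - y\<close> replaces it by its supplement. Both
  change only the sign of the cosine, hence the absolute value.\<close>

lemma cos_reduce_first_quadrant:
  fixes x M :: nat
  assumes M: "M > 0" and x: "\<not> 2 * M dvd x"
  obtains "cos (pi * real x / real (2 * M)) = 0"
  | j where "0 < j" "j < M" "\<bar>cos (pi * real x / real (2 * M))\<bar> = cos (pi * real j / real (2 * M))"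
proof -
  define q y where "q = x div (2 * M)" and "y = x mod (2 * M)"
  have y: "0 < y" "y < 2 * M" using M x by (auto simp: y_def mod_greater_zero_iff_not_dvd)
  have "real x = real q * real (2 * M) + real y"
    unfolding q_def y_def of_nat_mult[symmetric] of_nat_add[symmetric] by (simp only: div_mult_mod_eq)
  then have arg: "pi * real x / real (2 * M) = pi * real q + pi * real y / real (2 * M)"
    using M by (simp add: field_simps)
  have abs: "\<bar>cos (pi * real x / real (2 * M))\<bar> = \<bar>cos (pi * real y / real (2 * M))\<bar>"
    unfolding arg cos_add by (simp add: abs_mult)
  have first: "0 < cos (pi * real j / real (2 * M))" if "j < M" for j
  proof (rule cos_gt_zero_pi)
    show "pi * real j / real (2 * M) < pi / 2" using that by (simp add: field_simps)
    have "- (pi / 2) < 0" by simp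
    also have "0 \<le> pi * real j / real (2 * M)" by simp
    finally show "- (pi / 2) < pi * real j / real (2 * M)" .
  qed
  consider "y < M" | "y = M" | "M < y" by linarith
  then show thesis
  proof cases
    case 1
    then show ?thesis using that(2)[of y] y abs first[of y] by simp
  next
    case 2
    have "cos (pi * real y / real (2 * M)) = 0" using M 2 by (simp add: field_simps)
    then show ?thesis using that(1) abs by simp
  next
    case 3
    define w where "w = 2 * M - y"
    have w: "0 < w" "w < M" using y 3 by (auto simp: w_def)
    have "pi * real y / real (2 * M) = pi - pi * real w / real (2 * M)"
      using y M by (simp add: w_def of_nat_diff field_simps)
    then have "\<bar>cos (pi * real y / real (2 * M))\<bar> = \<bar>cos (pi * real w / real (2 * M))\<bar>"
      by simp
    then show ?thesis using that(2)[of w] w abs first[of w] by simp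
  qed
qed

text \<open>Whether \<open>n\<close> divides \<open>t * s\<close> depends only on
  \<open>gcd s n\<close>, so the set is a disjoint union of classes
  \<open>S \<inter> Sn n d\<close>.\<close>

lemma card_multiples_dvd:
  fixes n :: nat
  assumes "S \<subseteq> {..<n}" "0 \<notin> S"
    and dvd: "\<And>d. proper_divisor d n \<Longrightarrow> m dvd card (S \<inter> Sn n d)"
  shows "m dvd card {s \<in> S. n dvd t * s}"
proof -
  define D where "D = {d. proper_divisor d n \<and> n dvd t * d}"
  have fin: "finite S" using assms(1) finite_subset by blast
  have iff: "n dvd t * s \<longleftrightarrow> n dvd t * gcd s n" for s
    using gcd_mult_distrib_nat[of t s n] by (metis dvd_triv_right gcd_greatest_iff)
  have "{s \<in> S. n dvd t * s} = (\<Union>d\<in>D. S \<inter> Sn n d)"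
  proof (intro subset_antisym subsetI)
    fix s assume "s \<in> {s \<in> S. n dvd t * s}"
    then have s: "s \<in> S" "n dvd t * s" "0 < s" "s < n" using assms by (auto intro: gr0I)
    \<comment> \<open>The divisor is proper because \<open>0 < s < n\<close> gives
      \<open>gcd s n \<le> s\<close>.\<close>
    then have "gcd s n < n" by (metis gcd_le1_nat le_less_trans less_numeral_extra(3))
    then have "gcd s n \<in> D" using s iff by (auto simp: D_def proper_divisor_def)
    then show "s \<in> (\<Union>d\<in>D. S \<inter> Sn n d)" using s by (auto simp: Sn_def)
  qed (use iff in \<open>auto simp: D_def Sn_def\<close>)
  moreover have "card (\<Union>d\<in>D. S \<inter> Sn n d) = (\<Sum>d\<in>D. card (S \<inter> Sn n d))"
    by (rule card_UN_disjoint)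
      (use fin in \<open>auto simp: D_def proper_divisor_def Sn_def intro: finite_subset[of _ "{..<n}"]\<close>)
  moreover have "m dvd (\<Sum>d\<in>D. card (S \<inter> Sn n d))"
    by (rule dvd_sum) (auto simp: D_def dvd)
  ultimately show ?thesis by simp
qed

text \<open>The involution \<open>s \<mapsto> n - s\<close> of \<open>S\<close> conjugates every
  term, so the imaginary parts cancel.\<close>

lemma circulant_eigenvalue_real:
  assumes "circ_conn_set n S"
  shows "(\<Sum>s\<in>S. zchar n (- (int r * int s))) = of_real (\<Sum>s\<in>S. cos (2 * pi * real (r * s) / real n))"
proof -
  have S: "0 < s" "s < n" "n - s \<in> S" if "s \<in> S" for s
  proof -
    show s: "0 < s" "s < n"
      using assms that by (auto simp: circ_conn_set_def intro: gr0I)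
    have "(n - s) mod n \<in> S" using assms that by (simp add: circ_conn_set_def)
    then show "n - s \<in> S" using s by simp
  qed
  have cnj: "zchar n (- t) = cnj (zchar n t)" for t
    by (simp add: zchar_def cis_cnj)
  have per: "zchar n (int r * int (n - s)) = zchar n (- (int r * int s))" if "s \<in> S" for s
  proof -
    have "zchar n (int r * int n) = 1"
      using S[OF that] by (simp add: zchar_eq_1_iff)
    then show ?thesis
      using S[OF that] zchar_add[of n "int r * int n" "- (int r * int s)"]
      by (simp add: of_nat_diff right_diff_distrib)
  qed
  have "(\<Sum>s\<in>S. zchar n (- (int r * int s))) = (\<Sum>s\<in>S. zchar n (int r * int s))"
    by (rule sum.reindex_bij_witness[of _ "\<lambda>s. n - s" "\<lambda>s. n - s"]) (use S per in \<open>auto simp: less_imp_le\<close>)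
  then have "cnj (\<Sum>s\<in>S. zchar n (int r * int s)) = (\<Sum>s\<in>S. zchar n (int r * int s))"
    by (simp add: cnj)
  then have "Im (\<Sum>s\<in>S. zchar n (int r * int s)) = 0"
    by (metis complex_cnj_cancel_iff cnj.simps(2) equal_neg_zero)
  moreover have "Re (\<Sum>s\<in>S. zchar n (int r * int s)) = (\<Sum>s\<in>S. cos (2 * pi * real (r * s) / real n))"
    by (simp add: zchar_def)
  ultimately show ?thesis
    by (simp add: cnj complex_eq_iff sum_negf)
qed

lemma cos_int_multiple_pi:
  fixes x n :: nat
  assumes "n > 0" "n dvd 2 * x"
  shows "cos (2 * pi * real x / real n) = (if n dvd x then 1 else - 1)"
proof -
  obtain q where q: "2 * x = n * q" using assms(2) by blast
  have "2 * real x = real n * real q" using q by (metis of_nat_mult of_nat_numeral)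
  then have "2 * pi * real x / real n = pi * real q" using assms(1) by (simp add: field_simps)
  moreover have "n dvd x \<longleftrightarrow> even q"
  proof
    assume "n dvd x"
    then obtain p where "x = n * p" by blast
    then have "2 * p = q" using q assms(1) by simp
    then show "even q" by auto
  next
    assume "even q"
    then obtain p where "q = 2 * p" by blast
    then show "n dvd x" using q by simp
  qed
  ultimately show ?thesis by (simp add: uminus_power_if)
qed

theorem theorem3p3:
  fixes k n :: nat and S :: "nat set"
  assumes "n = 2 ^ k"
    and "circ_conn_set n S"
    and "\<forall>d. proper_divisor d n \<longrightarrow> card (S \<inter> Sn n d) mod 4 = 0"
  shows "almost_periodic_4Z1 n (cay_adj n S) \<and> almost_periodic_4Z1 n (laplacian (cay_adj n S))"
proof -
  have n: "n > 0" using assms(1) by simp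
  have S: "S \<subseteq> {..<n}" "0 \<notin> S" using assms(2) by (auto simp: circ_conn_set_def)
  have fin: "finite S" using S finite_subset by blast
  have card4: "4 dvd card {s \<in> S. n dvd t * s}" for t
    by (rule card_multiples_dvd) (use S assms(3) in auto)
  \<comment> \<open>This is \<open>n / 4\<close> for \<open>k \<ge> 2\<close>. For smaller
    \<open>k\<close> truncated subtraction gives \<open>M = 1\<close>, and no \<open>j\<close>
    satisfies \<open>0 < j < M\<close>.\<close>
  define M where "M = (2 :: nat) ^ (k - 2)"
  obtain \<tau> :: "nat \<Rightarrow> real" where
    \<tau>: "\<And>i. \<exists>m::int. \<tau> i = (4 * of_int m + 1) * pi / 2" and
    lim: "\<And>j. 0 < j \<Longrightarrow> j < M \<Longrightarrow> (\<lambda>i. cis (\<tau> i * cos (pi * real j / real (2 * M)))) \<longlonglongrightarrow> 1"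
    using recurrent_times[of "k - 2"] unfolding M_def by auto
  have cos_lim: "(\<lambda>i. cis (\<tau> i * cos (2 * pi * real x / real n))) \<longlonglongrightarrow> 1" if "\<not> n dvd 2 * x" for x
  proof -
    \<comment> \<open>For \<open>n = 1\<close> and \<open>n = 2\<close> every \<open>2 * x\<close>
      is a multiple of \<open>n\<close>.\<close>
    have "k \<noteq> 0" using that assms(1) by (cases k) auto
    moreover have "k \<noteq> 1" using that assms(1) by auto
    ultimately have "k = 2 + (k - 2)" by simp
    then have "(2 :: nat) ^ k = 2 ^ 2 * 2 ^ (k - 2)" by (metis power_add)
    then have nM: "n = 4 * M" by (simp add: assms(1) M_def)
    have M: "M > 0" "\<not> 2 * M dvd x" using that nM by (auto simp: M_def)
    have eq: "2 * pi * real x / real n = pi * real x / real (2 * M)" by (simp add: nM)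
    show ?thesis
      using M
    proof (cases rule: cos_reduce_first_quadrant)
      case 1
      then show ?thesis unfolding eq by simp
    next
      case (2 j)
      then have "cos (pi * real x / real (2 * M)) = cos (pi * real j / real (2 * M))
        \<or> cos (pi * real x / real (2 * M)) = - cos (pi * real j / real (2 * M))" by linarith
      then show ?thesis
        unfolding eq using lim[OF 2(1,2)] tendsto_cis_minus[OF lim[OF 2(1,2)]] by metis
    qed
  qed
  \<comment> \<open>The terms of \<open>ev r\<close> with \<open>n\<close> dividing \<open>2 * r * s\<close> are \<open>\<plusminus>1\<close>; they are grouped by \<open>gcd s n\<close>,
    so the hypothesis on \<open>S\<close> makes their sum a multiple of 4.\<close>
  define ev where "ev r = (\<Sum>s\<in>S. cos (2 * pi * real (r * s) / real n))" for r
  have ev_lim: "(\<lambda>i. cis (\<tau> i * ev r)) \<longlonglongrightarrow> 1" for r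
  proof -
    \<comment> \<open>If \<open>n\<close> divides \<open>r * s\<close>, then \<open>s\<close> counts
      \<open>2 - 1 = 1\<close>; if \<open>n\<close> divides only \<open>2 * r * s\<close>, it counts
      \<open>0 - 1 = -1\<close>. These are the values of the cosine.\<close>
    define a where "a = 2 * int (card {s \<in> S. n dvd r * s}) - int (card {s \<in> S. n dvd (2 * r) * s})"
    define f where "f s = (if n dvd (2 * r) * s then 0 else cos (2 * pi * real (r * s) / real n))" for s
    have "real_of_int a = (\<Sum>s\<in>S. 2 * (if n dvd r * s then 1 else 0) - (if n dvd (2 * r) * s then 1 else 0))"
      using fin by (simp add: a_def sum_subtractf sum.If_cases Int_def flip: sum_distrib_left)
    moreover have "cos (2 * pi * real (r * s) / real n)
      = 2 * (if n dvd r * s then 1 else 0) - (if n dvd (2 * r) * s then 1 else 0) + f s" for s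
      using cos_int_multiple_pi[OF n, of "r * s"] by (auto simp: f_def mult.assoc simp del: of_nat_mult)
    ultimately have ev: "ev r = real_of_int a + (\<Sum>s\<in>S. f s)"
      by (simp add: ev_def sum.distrib)
    have "4 dvd a"
      using card4[of r] card4[of "2 * r"] unfolding a_def
      by (intro dvd_diff dvd_mult) (metis of_nat_dvd_iff of_nat_numeral)+
    moreover have "(\<lambda>i. cis (\<tau> i * f s)) \<longlonglongrightarrow> 1" for s
      using cos_lim[of "r * s"] by (simp add: f_def mult.assoc)
    ultimately show ?thesis
      unfolding ev by (intro tendsto_cis_add tendsto_cis_sum tendsto_cis_multiple_4 \<tau>)
  qed
  have A: "cay_adj n S = fourier_mat n (\<lambda>r. of_real (ev r))"
    using cay_adj_fourier_mat[OF S(1)] circulant_eigenvalue_real[OF assms(2)] by (simp add: ev_def)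
  have L: "laplacian (cay_adj n S) = fourier_mat n (\<lambda>r. of_real (ev 0 - ev r))"
    by (simp add: A laplacian_fourier_mat)
  have "almost_periodic_4Z1 n (cay_adj n S)"
    unfolding A by (rule almost_periodic_fourier_mat[OF \<tau> ev_lim])
  moreover have "almost_periodic_4Z1 n (laplacian (cay_adj n S))"
    unfolding L
  proof (rule almost_periodic_fourier_mat[OF \<tau>])
    show "(\<lambda>i. cis (\<tau> i * (ev 0 - ev r))) \<longlonglongrightarrow> 1" for r
      using tendsto_cis_add[OF ev_lim tendsto_cis_minus[OF ev_lim]] by simp
  qed
  ultimately show ?thesis by simp
qed

end
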